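(* Let $n\in\mathbb{N}$, $N=n^2$, and let $P=\{p_1,\ldots,p_N\}\subset\mathbb{R}^2$ be a set of $N$ pairwise distinct points placed bijectively (arbitrarily) into the cells of an $n\times n$ grid. Run the following procedure: repeat { sort every row so that its points increase in $\prec_x$ from left to right; then sort every column so that its points increase in $\prec_y$ from bottom to top } until the grid is in a stable state. Then this procedure terminates after finitely many iterations, and the final grid is in a stable state.
   Context: Write $p=(p_1,p_2)$. Define $p\prec_x q$ iff $p_1<q_1$, or $p_1=q_1$ and $p_2<q_2$; and $p\prec_y q$ iff $p_2<q_2$, or $p_2=q_2$ and $p_1<q_1$. The grid has columns numbered left to right and rows numbered bottom to top, one point per cell. It is in a stable state iff within every row the points increase in $\prec_x$ from left to right and within every column the points increase in $\prec_y$ from bottom to top. *)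

theory Defs
  imports Complex_Main "HOL-Library.While_Combinator"
begin

type_synonym point = "real \<times> real"

definition prec_x :: "point \<Rightarrow> point \<Rightarrow> bool" (infix "\<prec>\<^sub>x" 50) where
  "p \<prec>\<^sub>x q \<longleftrightarrow> fst p < fst q \<or> fst p = fst q \<and> snd p < snd q"

definition prec_y :: "point \<Rightarrow> point \<Rightarrow> bool" (infix "\<prec>\<^sub>y" 50) where
  "p \<prec>\<^sub>y q \<longleftrightarrow> snd p < snd q \<or> snd p = snd q \<and> fst p < fst q"

interpretation x_order: linorder "\<lambda>p q. p = q \<or> p \<prec>\<^sub>x q" prec_x
  by unfold_locales (auto simp: prec_x_def prod_eq_iff)

interpretation y_order: linorder "\<lambda>p q. p = q \<or> p \<prec>\<^sub>y q" prec_y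
  by unfold_locales (auto simp: prec_y_def prod_eq_iff)

text \<open>
  A cell is a pair (column, row). Columns are numbered from left to right and rows from bottom
  to top, both starting at 0. Only the values on \<open>cells n\<close> are meaningful.
\<close>

type_synonym grid = "nat \<times> nat \<Rightarrow> point"

definition cells :: "nat \<Rightarrow> (nat \<times> nat) set" where
  "cells n = {..<n} \<times> {..<n}"

definition row :: "nat \<Rightarrow> grid \<Rightarrow> nat \<Rightarrow> point list" where
  "row n g j = map (\<lambda>i. g (i, j)) [0..<n]"

definition col :: "nat \<Rightarrow> grid \<Rightarrow> nat \<Rightarrow> point list" where
  "col n g i = map (\<lambda>j. g (i, j)) [0..<n]"

definition sort_rows :: "nat \<Rightarrow> grid \<Rightarrow> grid" where
  "sort_rows n g = (\<lambda>(i, j). if (i, j) \<in> cells n then x_order.sort (row n g j) ! i else g (i, j))"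

definition sort_cols :: "nat \<Rightarrow> grid \<Rightarrow> grid" where
  "sort_cols n g = (\<lambda>(i, j). if (i, j) \<in> cells n then y_order.sort (col n g i) ! j else g (i, j))"

definition stable_state :: "nat \<Rightarrow> grid \<Rightarrow> bool" where
  "stable_state n g \<longleftrightarrow>
     (\<forall>j<n. \<forall>i i'. i < i' \<and> i' < n \<longrightarrow> g (i, j) \<prec>\<^sub>x g (i', j)) \<and>
     (\<forall>i<n. \<forall>j j'. j < j' \<and> j' < n \<longrightarrow> g (i, j) \<prec>\<^sub>y g (i, j'))"

text \<open>
  The loop body is executed once before the exit condition is first tested. The result is
  \<open>None\<close> if the loop runs forever, and \<open>Some t\<close> if it stops after finitely many iterations in
  state \<open>t\<close>.
\<close>

definition repeat_until :: "('s \<Rightarrow> 's) \<Rightarrow> ('s \<Rightarrow> bool) \<Rightarrow> 's \<Rightarrow> 's option" where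
  "repeat_until body exit_cond s = while_option (\<lambda>t. \<not> exit_cond t) body (body s)"

definition grid_sort :: "nat \<Rightarrow> grid \<Rightarrow> grid option" where
  "grid_sort n = repeat_until (\<lambda>g. sort_cols n (sort_rows n g)) (stable_state n)"

end

theory Submission
  imports Defs
begin

text \<open>
  Let \<open>r\<^sub>x\<close>, \<open>r\<^sub>y\<close> be the ranks of a point of \<open>P\<close> in the two orders, and consider the sum of
  \<open>i * r\<^sub>x (g (i, j)) + j * r\<^sub>y (g (i, j))\<close> over all cells. Sorting the rows does not
  change the contribution of \<open>r\<^sub>y\<close>, since every point stays in its row; by the rearrangement
  inequality it increases the contribution of \<open>r\<^sub>x\<close>, strictly unless all rows are sorted already.
  The same holds for columns with the roles exchanged. So the sum, a bounded natural number,
  strictly increases with every iteration that starts in an unstable state.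
\<close>

section \<open>Position-weighted sums of lists\<close>

definition weighted_sum :: "('a \<Rightarrow> nat) \<Rightarrow> 'a list \<Rightarrow> nat" where
  "weighted_sum f xs = (\<Sum>i<length xs. i * f (xs ! i))"

lemma weighted_sum_Nil [simp]: "weighted_sum f [] = 0"
  by (simp add: weighted_sum_def)

text \<open>Prepending moves every entry of \<open>xs\<close> up one position, which adds each value
  once; \<open>x\<close> itself lands on position 0 and has weight 0.\<close>

lemma weighted_sum_Cons [simp]:
  "weighted_sum f (x # xs) = weighted_sum f xs + sum_list (map f xs)"
  by (simp add: weighted_sum_def sum.lessThan_Suc_shift sum.distrib sum_list_sum_nth
      atLeast0LessThan del: sum.lessThan_Suc)

lemma weighted_sum_map_upt:
  "weighted_sum f (map a [0..<n]) = (\<Sum>i<n. i * f (a i))"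
  by (simp add: weighted_sum_def)

lemma sum_list_map_upt: "sum_list (map f (map a [0..<n])) = (\<Sum>i<n. f (a i))"
  by (simp add: sum_list_sum_nth atLeast0LessThan)

section \<open>The rearrangement inequality for sorting, with its equality case\<close>

context linorder
begin

text \<open>Makes ranks strictly increasing: \<open>p\<close> itself is counted below
  \<open>q\<close> but not below \<open>p\<close>.\<close>

lemma card_less_strict_mono:
  assumes "finite P" "p \<in> P" "p < q"
  shows "card {r \<in> P. r < p} < card {r \<in> P. r < q}"
  using assms by (intro psubset_card_mono) auto

lemma sum_list_map_insort:
  fixes f :: "'a \<Rightarrow> nat"
  shows "sum_list (map f (insort x xs)) = f x + sum_list (map f xs)"
  by (induction xs) auto

lemma sum_list_map_sort:
  fixes f :: "'a \<Rightarrow> nat"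
  shows "sum_list (map f (sort xs)) = sum_list (map f xs)"
  by (induction xs) (auto simp: sum_list_map_insort)

lemma weighted_sum_insort:
  assumes "\<And>p q. p \<in> insert x (set ys) \<Longrightarrow> q \<in> insert x (set ys) \<Longrightarrow> p < q \<Longrightarrow> f p < f q"
  shows "weighted_sum f (x # ys) \<le> weighted_sum f (insort x ys)"
    and "weighted_sum f (x # ys) = weighted_sum f (insort x ys) \<Longrightarrow> insort x ys = x # ys"
proof -
  \<comment> \<open>This dichotomy gives both claims. Passing a single smaller \<open>y\<close>
    already gains \<open>f x - f y > 0\<close>, so the weak inequality suffices for the rest of the
    list.\<close>
  have "weighted_sum f (x # ys) < weighted_sum f (insort x ys) \<or> insort x ys = x # ys"
    using assms
  proof (induction ys)
    case (Cons y zs)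
    show ?case
    proof (cases "x \<le> y")
      case False
      then have "f y < f x"
        using Cons.prems by auto
      moreover have "weighted_sum f (x # zs) \<le> weighted_sum f (insort x zs)"
        using Cons.IH Cons.prems by fastforce
      ultimately show ?thesis
        using False by (simp add: sum_list_map_insort)
    qed simp
  qed simp
  then show "weighted_sum f (x # ys) \<le> weighted_sum f (insort x ys)"
    and "weighted_sum f (x # ys) = weighted_sum f (insort x ys) \<Longrightarrow> insort x ys = x # ys"
    by auto
qed

text \<open>Induction along insertion sort: sorting the tail and then inserting the head each never
  lower the sum, so equality at the ends forces both to change nothing.\<close>

lemma weighted_sum_sort:
  assumes "\<And>p q. p \<in> set xs \<Longrightarrow> q \<in> set xs \<Longrightarrow> p < q \<Longrightarrow> f p < f q"
  shows "weighted_sum f xs \<le> weighted_sum f (sort xs)"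
    and "weighted_sum f xs = weighted_sum f (sort xs) \<Longrightarrow> sort xs = xs"
proof -
  have "weighted_sum f xs \<le> weighted_sum f (sort xs) \<and>
    (weighted_sum f xs = weighted_sum f (sort xs) \<longrightarrow> sort xs = xs)"
    using assms
  proof (induction xs)
    case (Cons x xs)
    have IH: "weighted_sum f xs \<le> weighted_sum f (sort xs)"
      "weighted_sum f xs = weighted_sum f (sort xs) \<Longrightarrow> sort xs = xs"
      using Cons by auto
    have ins: "weighted_sum f (x # sort xs) \<le> weighted_sum f (insort x (sort xs))"
      "weighted_sum f (x # sort xs) = weighted_sum f (insort x (sort xs)) \<Longrightarrow>
        insort x (sort xs) = x # sort xs"
      using weighted_sum_insort[of x "sort xs" f] Cons.prems by auto
    show ?case
      using IH ins by (auto simp: sum_list_map_sort)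
  qed simp
  then show "weighted_sum f xs \<le> weighted_sum f (sort xs)"
    and "weighted_sum f xs = weighted_sum f (sort xs) \<Longrightarrow> sort xs = xs"
    by auto
qed

text \<open>Treats rows and columns alike: \<open>j\<close> numbers the lines and \<open>i\<close>
  the positions in a line. In the last claim the weight \<open>j\<close> is constant along a line,
  so only the line totals of \<open>v\<close> count, and sorting preserves them.\<close>

lemma sort_lines:
  fixes a b :: "nat \<Rightarrow> nat \<Rightarrow> 'a" and f v :: "'a \<Rightarrow> nat"
  assumes sort: "\<And>j. j < n \<Longrightarrow> map (b j) [0..<n] = sort (map (a j) [0..<n])"
    and mono: "\<And>p q. p \<in> P \<Longrightarrow> q \<in> P \<Longrightarrow> p < q \<Longrightarrow> f p < f q"
    and a_in: "\<And>i j. i < n \<Longrightarrow> j < n \<Longrightarrow> a j i \<in> P"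
  shows "(\<Sum>j<n. \<Sum>i<n. i * f (a j i)) \<le> (\<Sum>j<n. \<Sum>i<n. i * f (b j i))"
    and "(\<Sum>j<n. \<Sum>i<n. i * f (a j i)) = (\<Sum>j<n. \<Sum>i<n. i * f (b j i)) \<Longrightarrow>
      i < n \<Longrightarrow> j < n \<Longrightarrow> b j i = a j i"
    and "(\<Sum>j<n. \<Sum>i<n. j * v (b j i)) = (\<Sum>j<n. \<Sum>i<n. j * v (a j i))"
proof -
  have line: "(\<Sum>i<n. i * f (a j i)) \<le> (\<Sum>i<n. i * f (b j i))"
    "(\<Sum>i<n. i * f (a j i)) = (\<Sum>i<n. i * f (b j i)) \<Longrightarrow> map (b j) [0..<n] = map (a j) [0..<n]"
    if "j < n" for j
  proof -
    have "f p < f q" if "p \<in> set (map (a j) [0..<n])" "q \<in> set (map (a j) [0..<n])" "p < q" for p q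
      using that mono a_in \<open>j < n\<close> by auto
    note * = weighted_sum_sort[of "map (a j) [0..<n]" f, OF this]
    show "(\<Sum>i<n. i * f (a j i)) \<le> (\<Sum>i<n. i * f (b j i))"
      using *(1) unfolding sort[OF that, symmetric] weighted_sum_map_upt .
    show "map (b j) [0..<n] = map (a j) [0..<n]"
      if "(\<Sum>i<n. i * f (a j i)) = (\<Sum>i<n. i * f (b j i))"
      using *(2) that unfolding sort[OF \<open>j < n\<close>, symmetric] weighted_sum_map_upt by blast
  qed
  show "(\<Sum>j<n. \<Sum>i<n. i * f (a j i)) \<le> (\<Sum>j<n. \<Sum>i<n. i * f (b j i))"
    by (rule sum_mono) (simp add: line(1))
  show "b j i = a j i"
    if "(\<Sum>j<n. \<Sum>i<n. i * f (a j i)) = (\<Sum>j<n. \<Sum>i<n. i * f (b j i))" "i < n" "j < n"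
  proof -
    have "(\<Sum>i<n. i * f (a j i)) = (\<Sum>i<n. i * f (b j i))"
      \<comment> \<open>Equal totals of termwise comparable sums leave no strict inequality in any
        line.\<close>
      by (rule sum_mono_inv[OF that(1)]) (use line(1) that(3) in simp_all)
    from line(2)[OF that(3) this] show ?thesis
      using that(2) by simp
  qed
  have "(\<Sum>i<n. v (b j i)) = (\<Sum>i<n. v (a j i))" if "j < n" for j
    using sum_list_map_sort[of v "map (a j) [0..<n]"]
    unfolding sort[OF that, symmetric] sum_list_map_upt .
  then show "(\<Sum>j<n. \<Sum>i<n. j * v (b j i)) = (\<Sum>j<n. \<Sum>i<n. j * v (a j i))"
    by (simp flip: sum_distrib_left)
qed

lemma sort_lines_image:
  assumes "\<And>j. j < n \<Longrightarrow> map (b j) [0..<n] = sort (map (a j) [0..<n])"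
  shows "(\<Union>j<n. b j ` {..<n}) = (\<Union>j<n. a j ` {..<n})"
proof -
  have "b j ` {..<n} = a j ` {..<n}" if "j < n" for j
    using arg_cong[OF assms[OF that], of set] by (simp add: atLeast0LessThan)
  then show ?thesis
    by simp
qed

lemma sort_eq_imp_less:
  assumes "sort (map a [0..<n]) = map a [0..<n]" "inj_on a {..<n}" "i < i'" "i' < n"
  shows "a i < a i'"
proof -
  have "sorted (map a [0..<n])"
    using assms(1) by (metis sorted_sort)
  then have "a i \<le> a i'"
    using assms(3,4) sorted_nth_mono[of "map a [0..<n]" i i'] by simp
  moreover have "a i \<noteq> a i'"
    using assms(2-4) by (auto dest: inj_onD)
  ultimately show ?thesis
    by simp
qed

end

section \<open>Sorting the rows and columns of a grid\<close>

lemma image_cells_rows: "g ` cells n = (\<Union>j<n. (\<lambda>i. g (i, j)) ` {..<n})"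
  and image_cells_cols: "g ` cells n = (\<Union>i<n. (\<lambda>j. g (i, j)) ` {..<n})"
  by (auto simp: cells_def)

lemma row_sort_rows: "j < n \<Longrightarrow> row n (sort_rows n g) j = x_order.sort (row n g j)"
  by (rule nth_equalityI) (auto simp: row_def sort_rows_def cells_def)

lemma col_sort_cols: "i < n \<Longrightarrow> col n (sort_cols n g) i = y_order.sort (col n g i)"
  by (rule nth_equalityI) (auto simp: col_def sort_cols_def cells_def)

lemma image_sort_rows [simp]: "sort_rows n g ` cells n = g ` cells n"
  unfolding image_cells_rows
  by (rule x_order.sort_lines_image) (use row_sort_rows in \<open>simp add: row_def\<close>)

lemma image_sort_cols [simp]: "sort_cols n g ` cells n = g ` cells n"
  unfolding image_cells_cols
  by (rule y_order.sort_lines_image) (use col_sort_cols in \<open>simp add: col_def\<close>)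

text \<open>Sortedness alone gives weak inequalities; distinctness of the points makes them strict,
  as stability demands.\<close>

lemma stable_state_if_sorted:
  assumes "sort_rows n g = g" "sort_cols n g = g" "inj_on g (cells n)"
  shows "stable_state n g"
proof -
  have "g (i, j) \<prec>\<^sub>x g (i', j)" if "j < n" "i < i'" "i' < n" for i i' j
  proof (rule x_order.sort_eq_imp_less[where a = "\<lambda>i. g (i, j)"])
    show "x_order.sort (map (\<lambda>i. g (i, j)) [0..<n]) = map (\<lambda>i. g (i, j)) [0..<n]"
      using row_sort_rows[of j n g] assms(1) that by (simp add: row_def)
    show "inj_on (\<lambda>i. g (i, j)) {..<n}"
      using assms(3) that by (auto simp: inj_on_def cells_def)
  qed (use that in auto)
  moreover have "g (i, j) \<prec>\<^sub>y g (i, j')" if "i < n" "j < j'" "j' < n" for i j j'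
  proof (rule y_order.sort_eq_imp_less[where a = "\<lambda>j. g (i, j)"])
    show "y_order.sort (map (\<lambda>j. g (i, j)) [0..<n]) = map (\<lambda>j. g (i, j)) [0..<n]"
      using col_sort_cols[of i n g] assms(2) that by (simp add: col_def)
    show "inj_on (\<lambda>j. g (i, j)) {..<n}"
      using assms(3) that by (auto simp: inj_on_def cells_def)
  qed (use that in auto)
  ultimately show ?thesis
    by (auto simp: stable_state_def)
qed

section \<open>Ranks, potentials and their growth\<close>

text \<open>Unlike \<open>fst\<close>, the rank in a finite \<open>P\<close> is strictly increasing
  on \<open>P\<close> along the lexicographic order, and it is a natural number bounded by
  \<open>card P\<close>.\<close>

definition x_rank :: "point set \<Rightarrow> point \<Rightarrow> nat" where
  "x_rank P p = card {q \<in> P. q \<prec>\<^sub>x p}"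

definition y_rank :: "point set \<Rightarrow> point \<Rightarrow> nat" where
  "y_rank P p = card {q \<in> P. q \<prec>\<^sub>y p}"

text \<open>The outer sum runs over rows here and over columns in \<open>y_potential\<close>, so
  that the inner sums are the weighted sums of the lines being sorted.\<close>

definition x_potential :: "point set \<Rightarrow> nat \<Rightarrow> grid \<Rightarrow> nat" where
  "x_potential P n g = (\<Sum>j<n. \<Sum>i<n. i * x_rank P (g (i, j)))"

definition y_potential :: "point set \<Rightarrow> nat \<Rightarrow> grid \<Rightarrow> nat" where
  "y_potential P n g = (\<Sum>i<n. \<Sum>j<n. j * y_rank P (g (i, j)))"

lemma potential_sort_rows:
  assumes "finite P" "g ` cells n \<subseteq> P"
  shows "x_potential P n g \<le> x_potential P n (sort_rows n g)"
    and "x_potential P n g = x_potential P n (sort_rows n g) \<Longrightarrow> sort_rows n g = g"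
    and "y_potential P n (sort_rows n g) = y_potential P n g"
proof -
  have sort: "map (\<lambda>i. sort_rows n g (i, j)) [0..<n] = x_order.sort (map (\<lambda>i. g (i, j)) [0..<n])"
    if "j < n" for j
    using row_sort_rows[OF that] by (simp add: row_def)
  have mono: "x_rank P p < x_rank P q" if "p \<in> P" "q \<in> P" "p \<prec>\<^sub>x q" for p q
    unfolding x_rank_def using assms(1) that by (intro x_order.card_less_strict_mono)
  have g_in: "g (i, j) \<in> P" if "i < n" "j < n" for i j
    using assms(2) that by (auto simp: cells_def)
  note * = x_order.sort_lines[where a = "\<lambda>j i. g (i, j)" and b = "\<lambda>j i. sort_rows n g (i, j)"
      and f = "x_rank P", OF sort mono g_in]
  show "x_potential P n g \<le> x_potential P n (sort_rows n g)"
    unfolding x_potential_def by (rule *(1))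
  show "sort_rows n g = g" if "x_potential P n g = x_potential P n (sort_rows n g)"
  proof
    fix c :: "nat \<times> nat"
    obtain i j where c: "c = (i, j)"
      by (cases c)
    show "sort_rows n g c = g c"
    \<comment> \<open>Equality of grids is equality of functions; outside the cells
      \<open>sort_rows\<close> is the identity by definition.\<close>
    proof (cases "i < n \<and> j < n")
      case True
      show ?thesis
        unfolding c by (rule *(2)) (use that True in \<open>simp_all add: x_potential_def\<close>)
    next
      case False
      then show ?thesis
        by (auto simp: c sort_rows_def cells_def)
    qed
  qed
  show "y_potential P n (sort_rows n g) = y_potential P n g"
    \<comment> \<open>Swapping the sums groups \<open>y_potential\<close> by rows, where the weight
      \<open>j\<close> is constant; \<open>sort_lines\<close> then applies with
      \<open>y_rank P\<close> as \<open>v\<close>.\<close>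
    unfolding y_potential_def
    by (subst (1 2) sum.swap) (rule *(3))
qed

text \<open>The mirror image of \<open>potential_sort_rows\<close>, with rows and columns and the
  two orders exchanged.\<close>

lemma potential_sort_cols:
  assumes "finite P" "g ` cells n \<subseteq> P"
  shows "y_potential P n g \<le> y_potential P n (sort_cols n g)"
    and "y_potential P n g = y_potential P n (sort_cols n g) \<Longrightarrow> sort_cols n g = g"
    and "x_potential P n (sort_cols n g) = x_potential P n g"
proof -
  have sort: "map (\<lambda>j. sort_cols n g (i, j)) [0..<n] = y_order.sort (map (\<lambda>j. g (i, j)) [0..<n])"
    if "i < n" for i
    using col_sort_cols[OF that] by (simp add: col_def)
  have mono: "y_rank P p < y_rank P q" if "p \<in> P" "q \<in> P" "p \<prec>\<^sub>y q" for p q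
    unfolding y_rank_def using assms(1) that by (intro y_order.card_less_strict_mono)
  have g_in: "g (i, j) \<in> P" if "j < n" "i < n" for i j
    using assms(2) that by (auto simp: cells_def)
  note * = y_order.sort_lines[where a = "\<lambda>i j. g (i, j)" and b = "\<lambda>i j. sort_cols n g (i, j)"
      and f = "y_rank P", OF sort mono g_in]
  show "y_potential P n g \<le> y_potential P n (sort_cols n g)"
    unfolding y_potential_def by (rule *(1))
  show "sort_cols n g = g" if "y_potential P n g = y_potential P n (sort_cols n g)"
  proof
    fix c :: "nat \<times> nat"
    obtain i j where c: "c = (i, j)"
      by (cases c)
    show "sort_cols n g c = g c"
    proof (cases "i < n \<and> j < n")
      case True
      show ?thesis
        unfolding c by (rule *(2)) (use that True in \<open>simp_all add: y_potential_def\<close>)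
    next
      case False
      then show ?thesis
        by (auto simp: c sort_cols_def cells_def)
    qed
  qed
  show "x_potential P n (sort_cols n g) = x_potential P n g"
    unfolding x_potential_def
    by (subst (1 2) sum.swap) (rule *(3))
qed

lemma potential_less_sort:
  assumes "finite P" "g ` cells n \<subseteq> P" "inj_on g (cells n)" "\<not> stable_state n g"
  defines "g' \<equiv> sort_cols n (sort_rows n g)"
  shows "x_potential P n g + y_potential P n g < x_potential P n g' + y_potential P n g'"
proof (rule ccontr)
  assume not_less: "\<not> ?thesis"
  have "sort_rows n g ` cells n \<subseteq> P"
    using assms(2) by simp
  note rows = potential_sort_rows[OF assms(1,2)] and cols = potential_sort_cols[OF assms(1) this]
  \<comment> \<open>Each potential is fixed by one of the two sorts and not lowered by the other.
    Without a gain in the sum, neither sort gains anything, so both act trivially.\<close>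
  have "x_potential P n g = x_potential P n (sort_rows n g)"
    and y: "y_potential P n (sort_rows n g) = y_potential P n g'"
    using rows(1,3) cols(1,3) not_less unfolding g'_def by linarith+
  then have "sort_rows n g = g" "sort_cols n g = g"
    using rows(2) cols(2) y unfolding g'_def by auto
  then show False
    using stable_state_if_sorted assms(3,4) by blast
qed

text \<open>A crude count: each of the \<open>n * n\<close> cells contributes a position below
  \<open>n\<close> times a rank of at most \<open>card P\<close>.\<close>

lemma potential_le:
  assumes "finite P"
  shows "x_potential P n g \<le> n * (n * (n * card P))"
    and "y_potential P n g \<le> n * (n * (n * card P))"
proof -
  have "x_rank P p \<le> card P" "y_rank P p \<le> card P" for p
    using assms by (auto simp: x_rank_def y_rank_def intro: card_mono)
  then have "(\<Sum>i<n. i * x_rank P (a i)) \<le> n * (n * card P)"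
    "(\<Sum>i<n. i * y_rank P (a i)) \<le> n * (n * card P)" for a
    using sum_bounded_above[of "{..<n}" _ "n * card P"] by (auto simp: mult_le_mono)
  then show "x_potential P n g \<le> n * (n * (n * card P))"
    and "y_potential P n g \<le> n * (n * (n * card P))"
    unfolding x_potential_def y_potential_def
    using sum_bounded_above[of "{..<n}" _ "n * (n * card P)"] by auto
qed

section \<open>Termination of the loop\<close>

theorem theorem5:
  fixes n N :: nat and P :: "(real \<times> real) set" and g :: grid
  assumes "N = n\<^sup>2"
    and "finite P" and "card P = N"
    and "bij_betw g (cells n) P"
  shows "\<exists>g'. grid_sort n g = Some g' \<and> stable_state n g'"
proof -
  let ?step = "\<lambda>g. sort_cols n (sort_rows n g)"
  let ?potential = "\<lambda>g. x_potential P n g + y_potential P n g"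
  let ?bound = "2 * (n * (n * (n * card P)))"
  have card_cells: "card (cells n) = card P"
    using assms(1,3) by (simp add: cells_def power2_eq_square)
  \<comment> \<open>The loop invariant is that the grid shows exactly the points of
    \<open>P\<close>; the decreasing measure is the distance of the potential from its
    bound.\<close>
  have "?step h ` cells n = P \<and> ?bound - ?potential (?step h) < ?bound - ?potential h"
    if "h ` cells n = P" "\<not> stable_state n h" for h
  proof -
    \<comment> \<open>There are as many cells as points, so a placement onto \<open>P\<close> is
      injective.\<close>
    have "inj_on h (cells n)"
      using that(1) card_cells by (intro eq_card_imp_inj_on) (auto simp: cells_def)
    then have "?potential h < ?potential (?step h)"
      using that assms(2) by (intro potential_less_sort) auto
    \<comment> \<open>Subtraction on naturals truncates at 0; this bound ensures that the measure
      really drops.\<close>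
    moreover have "?potential (?step h) \<le> ?bound"
      using potential_le[OF assms(2), of n "?step h"] by simp
    ultimately show ?thesis
      using that(1) by auto
  qed
  \<comment> \<open>The loop proper starts from \<open>?step g\<close>, since the body runs once
    before the first test; the sorts keep the image \<open>P\<close>, so the invariant holds
    there.\<close>
  then have "\<exists>g'. while_option (\<lambda>h. \<not> stable_state n h) ?step (?step g) = Some g'"
    by (rule measure_while_option_Some[where P = "\<lambda>h. h ` cells n = P"])
      (use assms(4) in \<open>auto simp: bij_betw_def\<close>)
  then show ?thesis
    unfolding grid_sort_def repeat_until_def using while_option_stop by fastforce
qed

end
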